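(* Let $n,r,t$ be positive integers with $1 \leq t \leq r$, let $u$ be a non-negative real number such that $u > \frac{6-t}{3}$, and suppose $n \geq (t+u+2)(r-t)$. If $\mathcal{A} \subseteq M_{n,r}$ and $\mathcal{A}$ is $t$-intersecting, then \[|\mathcal{A}| \leq \binom{n+r-t-1}{r-t}.\] Moreover, if $u > 0$, then the bound is attained if and only if $\mathcal{A} = \left\{ A \in M_{n,r} : T \subseteq \mathrm{S}_A \right\}$ for some $T \in \binom{[n]}{t}$.
   Context: $[n]=\{1,\dots,n\}$, and $\binom{[n]}{t}$ is the family of all $t$-element subsets of $[n]$. Multisets of positive integers are represented by (weakly) increasing sequences: for positive integers $n,r$, $M_{n,r} = \{(a_1,\dots,a_r) : a_1 \leq \dots \leq a_r,\ a_1,\dots,a_r \in [n]\}$. The support of $A=(a_1,\dots,a_r)$ is the set $\mathrm{S}_A = \{a_1,\dots,a_r\}$. A set $\mathcal{A}$ of multisets is $t$-intersecting if $|\mathrm{S}_A \cap \mathrm{S}_B| \geq t$ for all $A,B \in \mathcal{A}$, not necessarily distinct (so in particular every member has support of size at least $t$). *)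

theory Defs
  imports Complex_Main
begin

definition multisets :: "nat \<Rightarrow> nat \<Rightarrow> nat list set" where
  "multisets n r = {a. length a = r \<and> sorted a \<and> set a \<subseteq> {1..n}}"

text \<open>
  As multisets are sorted lists, the support of \<open>a\<close> is \<open>set a\<close>.
  The two members compared below may be equal, so every member has support of size at least \<open>t\<close>.
\<close>

definition t_intersecting :: "nat \<Rightarrow> nat list set \<Rightarrow> bool" where
  "t_intersecting t \<A> \<longleftrightarrow> (\<forall>a\<in>\<A>. \<forall>b\<in>\<A>. card (set a \<inter> set b) \<ge> t)"

end

theory Submission imports Defs begin

text \<open>
  A multiset enters the problem only through its support, so the whole question is about families
  \<open>F\<close> of subsets of \<open>{1..n}\<close>, where a set of size \<open>a\<close> has as its weight the number of multisets of
  size \<open>r\<close> supported on it, \<open>(r - 1) choose (r - a)\<close>. Adding all supersets of members keeps a family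
  \<open>t\<close>-intersecting and does not lower its weight, so families may be taken closed under supersets.

  The bound is proved by removing the points \<open>n, n - 1, \<dots>, t + 1\<close> one after the other
  (\<open>eliminate_last\<close>). When only \<open>{1..l}\<close> is left, a set of size \<open>a\<close> represents all its extensions by
  the removed points and weighs \<open>(n + r - 1 - l) choose (r - a)\<close>; this is Pascal's rule, applied once
  per point. Once \<open>l = t\<close>, the only set that can remain is \<open>{1..t}\<close>, and its weight is the bound.

  To remove the point \<open>z = l + 1\<close>, first shift: replace \<open>z\<close> by smaller points as long as this changes
  the family (\<open>exists_stable\<close>). The obstacle is then the collection \<open>P\<close> of those \<open>A \<subseteq> {1..l}\<close> for which
  \<open>A \<union> {z}\<close> is in the family but \<open>A\<close> is not. Two sets of \<open>P\<close> share \<open>t\<close> points, unless they cover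
  \<open>{1..l}\<close> and meet in \<open>t - 1\<close> points; in the latter case their sizes add up to \<open>s = l + t - 1\<close>. If a
  subcollection \<open>C\<close> of \<open>P\<close> is \<open>t\<close>-intersecting, the sets of the family that avoid \<open>z\<close>, together with
  \<open>C\<close>, form a \<open>t\<close>-intersecting family on \<open>{1..l}\<close>. What is lost are the sets \<open>A \<union> {z}\<close> with \<open>A \<in> P - C\<close>;
  what is gained are the sets of \<open>C\<close> themselves. A good \<open>C\<close> exists (\<open>select_subfamily\<close>): for sizes
  \<open>a \<noteq> s - a\<close> keep the more profitable of the two classes, and for \<open>a = s - a\<close> keep the sets that miss
  a suitable point \<open>y\<close>, no two of which cover \<open>{1..l}\<close>. This is the pushing argument of Ahlswede and
  Khachatrian's complete intersection theorem. The weights allow it when \<open>r = t\<close> or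
  \<open>n \<ge> t (r - t) + 2\<close>.

  If \<open>r = t\<close> or that inequality is strict, the weight grows strictly whenever \<open>P\<close> contains a set of
  positive weight. A family of maximum weight therefore keeps its weight when \<open>P\<close> is just discarded,
  and by induction it contains a set of size \<open>t\<close>. Shifting does not alter the sizes of the members, so
  the family before shifting also has a member \<open>T\<close> of size \<open>t\<close>. All members meet \<open>T\<close> in \<open>t\<close> points, that is,
  contain it, and the extremal structure follows without undoing any shift.
\<close>

section \<open>Families of sets and shifting\<close>

definition t_inter :: "nat \<Rightarrow> nat set set \<Rightarrow> bool" where
  "t_inter t F \<longleftrightarrow> (\<forall>A\<in>F. \<forall>B\<in>F. t \<le> card (A \<inter> B))"

definition up_closed :: "nat set \<Rightarrow> nat set set \<Rightarrow> bool" where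
  "up_closed X F \<longleftrightarrow> (\<forall>A\<in>F. \<forall>B. A \<subseteq> B \<longrightarrow> B \<subseteq> X \<longrightarrow> B \<in> F)"

text \<open>
  A set stays where it is when its image is already in \<open>F\<close>; this makes the map injective on \<open>F\<close>.
\<close>

definition shift_set :: "nat \<Rightarrow> nat \<Rightarrow> nat set set \<Rightarrow> nat set \<Rightarrow> nat set" where
  "shift_set x z F A =
    (if z \<in> A \<and> x \<notin> A \<and> insert x (A - {z}) \<notin> F then insert x (A - {z}) else A)"

lemma t_interD: "t_inter t F \<Longrightarrow> A \<in> F \<Longrightarrow> B \<in> F \<Longrightarrow> t \<le> card (A \<inter> B)"
  by (auto simp: t_inter_def)

lemma up_closedD: "up_closed X F \<Longrightarrow> A \<in> F \<Longrightarrow> A \<subseteq> B \<Longrightarrow> B \<subseteq> X \<Longrightarrow> B \<in> F"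
  by (auto simp: up_closed_def)

lemma card_exchange:
  assumes "finite S" "z \<in> S" "x \<notin> S"
  shows "card (insert x (S - {z})) = card S"
proof -
  have "card S > 0" using assms by (auto simp: card_gt_0_iff)
  then show ?thesis using assms by (simp add: card_insert_if)
qed

lemma shift_inj: "inj_on (shift_set x z F) F"
proof (rule inj_onI)
  fix A B assume AB: "A \<in> F" "B \<in> F" and eq: "shift_set x z F A = shift_set x z F B"
  have "A = B" if "z \<in> A" "x \<notin> A" "z \<in> B" "x \<notin> B" "insert x (A - {z}) = insert x (B - {z})"
  proof -
    have "A - {z} = B - {z}" using that by (metis Diff_iff insert_ident)
    then show ?thesis using that by (metis insert_Diff)
  qed
  then show "A = B" using eq AB by (auto simp: shift_set_def split: if_splits)
qed

lemma shift_card: "finite A \<Longrightarrow> card (shift_set x z F A) = card A"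
  using card_exchange[of A z x] by (simp add: shift_set_def del: card_insert_disjoint)

text \<open>
  Only a moved and an unmoved member need care. The delicate case is an unmoved \<open>B\<close> with \<open>z \<in> B\<close> and
  \<open>x \<notin> B\<close>: it stayed because its shifted copy was already in \<open>F\<close>, and it meets the moved set exactly
  where that copy meets the set before the move.
\<close>

lemma shift_t_inter:
  assumes fin: "\<And>A. A \<in> F \<Longrightarrow> finite A" and ti: "t_inter t F"
  shows "t_inter t (shift_set x z F ` F)"
proof -
  let ?s = "shift_set x z F"
  define moved where "moved A \<longleftrightarrow> z \<in> A \<and> x \<notin> A \<and> insert x (A - {z}) \<notin> F" for A
  have s: "?s A = (if moved A then insert x (A - {z}) else A)" for A
    by (simp add: shift_set_def moved_def)
  have mixed: "t \<le> card (insert x (A - {z}) \<inter> B)"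
    if A: "A \<in> F" "moved A" and B: "B \<in> F" "\<not> moved B" for A B
  proof -
    have t: "t \<le> card (A \<inter> B)" using ti A B by (auto dest: t_interD)
    have f: "finite A" "finite B" using fin A B by auto
    consider "z \<notin> B" | "z \<in> B" "x \<in> B" | "z \<in> B" "x \<notin> B" by blast
    then show ?thesis
    proof cases
      case 1
      then have "A \<inter> B \<subseteq> insert x (A - {z}) \<inter> B" by auto
      then show ?thesis using t f by (meson card_mono finite_Int finite_insert le_trans)
    next
      case 2
      then have "insert x (A - {z}) \<inter> B = insert x ((A \<inter> B) - {z})" by auto
      then show ?thesis using t f 2 A by (simp add: card_exchange moved_def)
    next
      case 3
      then have "insert x (B - {z}) \<in> F" using B by (auto simp: moved_def)
      then have "t \<le> card (A \<inter> insert x (B - {z}))" using ti A by (auto dest: t_interD)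
      moreover have "A \<inter> insert x (B - {z}) = insert x (A - {z}) \<inter> B"
        using 3 A by (auto simp: moved_def)
      ultimately show ?thesis by simp
    qed
  qed
  have "t \<le> card (?s A \<inter> ?s B)" if AB: "A \<in> F" "B \<in> F" for A B
  proof -
    have t: "t \<le> card (A \<inter> B)" using ti AB by (auto dest: t_interD)
    have f: "finite A" "finite B" using fin AB by auto
    consider "moved A" "moved B" | "moved A" "\<not> moved B" | "\<not> moved A" "moved B"
      | "\<not> moved A" "\<not> moved B" by blast
    then show ?thesis
    proof cases
      case 1
      then have "?s A \<inter> ?s B = insert x ((A \<inter> B) - {z})" by (auto simp: s)
      then show ?thesis using t f 1 by (simp add: card_exchange moved_def)
    next
      case 2 then show ?thesis using mixed AB by (simp add: s)
    next
      case 3 then show ?thesis using mixed[OF AB(2) 3(2) AB(1) 3(1)] by (simp add: s Int_commute)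
    next
      case 4 then show ?thesis using t by (simp add: s)
    qed
  qed
  then show ?thesis by (auto simp: t_inter_def)
qed

text \<open>
  A superset \<open>B\<close> of a moved set \<open>A - {z} \<union> {x}\<close> that is not itself in \<open>F\<close> avoids \<open>z\<close>, and
  \<open>B - {x} \<union> {z}\<close> contains \<open>A\<close>, lies in \<open>F\<close> and moves to \<open>B\<close>. A superset of an unmoved set is in \<open>F\<close>
  and does not move, for otherwise its missing image would contain a member of \<open>F\<close>.
\<close>

lemma shift_up_closed:
  assumes up: "up_closed X F" and xz: "x \<in> X" "z \<in> X"
  shows "up_closed X (shift_set x z F ` F)"
  unfolding up_closed_def
proof (intro ballI allI impI)
  let ?s = "shift_set x z F"
  fix A' B assume "A' \<in> ?s ` F" and sub: "A' \<subseteq> B" "B \<subseteq> X"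
  then obtain A where A: "A \<in> F" "A' = ?s A" by auto
  show "B \<in> ?s ` F"
  proof (cases "z \<in> A \<and> x \<notin> A \<and> insert x (A - {z}) \<notin> F")
    case True
    then have A': "A' = insert x (A - {z})" using A by (simp add: shift_set_def)
    show ?thesis
    proof (cases "B \<in> F")
      case BF: True
      then have "?s B = B" using A' sub by (auto simp: shift_set_def)
      then show ?thesis using BF by (metis imageI)
    next
      case False
      have zB: "z \<notin> B"
      proof
        assume "z \<in> B"
        then have "A \<subseteq> B" using A' sub by auto
        then show False using up A sub False by (auto dest: up_closedD)
      qed
      let ?D = "insert z (B - {x})"
      have "A \<subseteq> ?D" "?D \<subseteq> X" using True A' sub xz by auto
      then have D: "?D \<in> F" using up A by (auto dest: up_closedD)
      have "x \<in> B" "x \<noteq> z" using A' sub True by auto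
      then have "insert x (?D - {z}) = B" "x \<notin> ?D" using zB by auto
      then have "?s ?D = B" using False by (simp add: shift_set_def)
      then show ?thesis using D by (metis imageI)
    qed
  next
    case False
    then have A': "A' = A" using A by (auto simp: shift_set_def)
    have B: "B \<in> F" using up A sub A' by (auto dest: up_closedD)
    have "?s B = B"
    proof (rule ccontr)
      assume "?s B \<noteq> B"
      then have B': "z \<in> B" "x \<notin> B" "insert x (B - {z}) \<notin> F"
        by (auto simp: shift_set_def split: if_splits)
      have sX: "insert x (B - {z}) \<subseteq> X" using sub xz by auto
      have "\<exists>C\<in>F. C \<subseteq> insert x (B - {z})"
      proof (cases "z \<in> A")
        case True
        then have "insert x (A - {z}) \<in> F" using False B' sub A' by auto
        then show ?thesis using sub A' by (intro bexI[of _ "insert x (A - {z})"]) auto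
      next
        case False then show ?thesis using A sub A' by (intro bexI[of _ A]) auto
      qed
      then show False using up B' sX by (auto dest: up_closedD)
    qed
    then show ?thesis using B by (metis imageI)
  qed
qed

text \<open>
  A shift that changes the family lowers the number of members through \<open>z\<close>, so finitely many shifts
  suffice. Everything that depends only on the sizes of the members is preserved.
\<close>

lemma exists_stable:
  assumes X: "finite X" "z \<in> X"
    and "F \<subseteq> Pow X" "t_inter t F" "up_closed X F"
  shows "\<exists>G \<subseteq> Pow X. t_inter t G \<and> up_closed X G \<and> card ` G = card ` F \<and>
    (\<forall>f :: nat \<Rightarrow> nat. (\<Sum>A\<in>G. f (card A)) = (\<Sum>A\<in>F. f (card A))) \<and>
    (\<forall>A\<in>G. z \<in> A \<longrightarrow> (\<forall>x\<in>X - A. insert x (A - {z}) \<in> G))"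
  using assms(3-)
proof (induction "card {A \<in> F. z \<in> A}" arbitrary: F rule: less_induct)
  case less
  show ?case
  proof (cases "\<forall>A\<in>F. z \<in> A \<longrightarrow> (\<forall>x\<in>X - A. insert x (A - {z}) \<in> F)")
    case True
    then show ?thesis using less.prems by (intro exI[of _ F]) auto
  next
    case False
    then obtain A x where A: "A \<in> F" "z \<in> A" "x \<in> X" "x \<notin> A" "insert x (A - {z}) \<notin> F" by auto
    let ?s = "shift_set x z F"
    let ?F = "?s ` F"
    have fin: "finite B" if "B \<in> F" for B using that less.prems(1) X by (auto intro: finite_subset)
    have finF: "finite F" using less.prems(1) X finite_subset by auto
    have z: "B \<in> F" "?s B = B" if "B \<in> ?F" "z \<in> B" for B
      using that A by (auto simp: shift_set_def split: if_splits)
    have "A \<notin> ?F" using z[of A] A by (auto simp: shift_set_def)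
    moreover have "{B \<in> ?F. z \<in> B} \<subseteq> {B \<in> F. z \<in> B}" using z(1) by blast
    ultimately have "{B \<in> ?F. z \<in> B} \<subset> {B \<in> F. z \<in> B}" using A(1,2) by blast
    then have dec: "card {B \<in> ?F. z \<in> B} < card {B \<in> F. z \<in> B}"
      using finF by (intro psubset_card_mono) auto
    have sub: "?F \<subseteq> Pow X" using less.prems(1) A by (auto simp: shift_set_def)
    obtain G where G: "G \<subseteq> Pow X" "t_inter t G" "up_closed X G" "card ` G = card ` ?F"
      "\<forall>f :: nat \<Rightarrow> nat. (\<Sum>A\<in>G. f (card A)) = (\<Sum>A\<in>?F. f (card A))"
      "\<forall>A\<in>G. z \<in> A \<longrightarrow> (\<forall>x\<in>X - A. insert x (A - {z}) \<in> G)"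
      using less.hyps[OF dec sub shift_t_inter[OF fin less.prems(2)]
        shift_up_closed[OF less.prems(3) A(3) X(2)]] by auto
    have "card ` ?F = card ` F" using shift_card[OF fin] by (auto simp: image_image)
    moreover have "(\<Sum>A\<in>?F. f (card A)) = (\<Sum>A\<in>F. f (card A))" for f :: "nat \<Rightarrow> nat"
      using shift_card[OF fin] by (subst sum.reindex[OF shift_inj]) auto
    ultimately show ?thesis using G by (intro exI[of _ G]) auto
  qed
qed

section \<open>Selecting a t-intersecting subfamily\<close>

text \<open>
  Two classes with \<open>p\<close> and \<open>q\<close> members exclude each other. Keeping one of them replaces its weight
  \<open>v\<close> per member by \<open>c + v\<close> and gives up the other class. If neither choice paid off, then
  \<open>p * ca < q * vb\<close> and \<open>q * cb < p * va\<close>, and multiplying the two contradicts \<open>va * vb \<le> ca * cb\<close>.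
  Here and below, the flag \<open>st\<close> asks for a strict gain under strict hypotheses, which is needed to
  characterise equality.
\<close>

lemma better_class:
  fixes p q ca va cb vb :: nat
  assumes weak: "p > 0 \<Longrightarrow> q > 0 \<Longrightarrow> va * vb \<le> ca * cb"
    and strict: "p > 0 \<Longrightarrow> q > 0 \<Longrightarrow> st \<Longrightarrow> va * vb > 0 \<Longrightarrow> va * vb < ca * cb"
    and pos: "p > 0 \<Longrightarrow> st \<Longrightarrow> ca + va > 0 \<Longrightarrow> ca > 0" "q > 0 \<Longrightarrow> st \<Longrightarrow> cb + vb > 0 \<Longrightarrow> cb > 0"
  defines "gain D \<equiv> p * va + q * vb \<le> D \<and>
      (st \<and> (p * (ca + va) > 0 \<or> q * (cb + vb) > 0) \<longrightarrow> p * va + q * vb < D)"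
  shows "gain (p * (ca + va)) \<or> gain (q * (cb + vb))"
proof (rule ccontr)
  assume n: "\<not> ?thesis"
  have 1: "p * ca \<le> q * vb" "q * cb \<le> p * va"
    using n by (auto simp: gain_def algebra_simps)
  have prod: "(p * q) * (ca * cb) \<le> (p * q) * (va * vb)"
    using mult_mono[OF 1] by (simp add: algebra_simps)
  show False
  proof (cases "st \<and> (p * (ca + va) > 0 \<or> q * (cb + vb) > 0)")
    case True
    then have st: st by simp
    have "p * ca > 0 \<or> q * cb > 0" using True pos by auto
    then have "p > 0 \<and> q > 0 \<and> (va > 0 \<or> vb > 0)" using 1 by (auto intro!: Nat.gr0I)
    moreover from this have "va > 0 \<and> vb > 0" using pos st 1 by (auto intro!: Nat.gr0I)
    ultimately show False using strict st prod by auto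
  next
    case False
    then have 2: "p * ca < q * vb" "q * cb < p * va"
      using n by (auto simp: gain_def algebra_simps)
    have "(p * ca) * (q * cb) < (q * vb) * (p * va)"
      using mult_strict_mono'[OF 2] by simp
    then have "(p * q) * (ca * cb) < (p * q) * (va * vb)" by (simp add: algebra_simps)
    moreover have "p > 0" "q > 0" using 2 by (auto intro!: Nat.gr0I)
    ultimately show False using weak by (auto simp: not_less[symmetric])
  qed
qed

text \<open>
  Double counting of the pairs \<open>(y, A)\<close> with \<open>y \<notin> A\<close>: some \<open>y\<close> is missed by at least the average number
  of members.
\<close>

lemma missed_element:
  assumes "finite P" "\<And>A. A \<in> P \<Longrightarrow> A \<subseteq> {1..l} \<and> card A = a" "l \<ge> 1"
  shows "\<exists>y\<in>{1..l}. card P * (l - a) \<le> l * card {A \<in> P. y \<notin> A}"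
proof (rule ccontr)
  assume "\<not> ?thesis"
  then have lt: "\<And>y. y \<in> {1..l} \<Longrightarrow> l * card {A \<in> P. y \<notin> A} < card P * (l - a)" by force
  have "(\<Sum>y\<in>{1..l}. card {A \<in> P. y \<notin> A}) = (\<Sum>y\<in>{1..l}. \<Sum>A\<in>P. if y \<notin> A then 1 else 0)"
    using assms(1) by (simp add: sum.If_cases Collect_conj_eq)
  also have "\<dots> = (\<Sum>A\<in>P. \<Sum>y\<in>{1..l}. if y \<notin> A then 1 else 0)" by (rule sum.swap)
  also have "\<dots> = (\<Sum>A\<in>P. l - a)"
  proof (rule sum.cong[OF refl])
    fix A assume A: "A \<in> P"
    have "(\<Sum>y\<in>{1..l}. if y \<notin> A then 1 else 0) = card ({1..l} - A)"
      by (simp add: sum.If_cases Diff_eq Compl_eq)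
    also have "\<dots> = l - a" using assms(2)[OF A] by (subst card_Diff_subset) (auto intro: finite_subset)
    finally show "(\<Sum>y\<in>{1..l}. if y \<notin> A then 1 else 0) = l - a" .
  qed
  finally have eq: "(\<Sum>y\<in>{1..l}. card {A \<in> P. y \<notin> A}) = card P * (l - a)" by simp
  have "(\<Sum>y\<in>{1..l}. l * card {A \<in> P. y \<notin> A}) < (\<Sum>y\<in>{1..l}. card P * (l - a))"
    using lt assms(3) by (intro sum_strict_mono) auto
  then show False using eq by (simp add: sum_distrib_left[symmetric])
qed

text \<open>
  In the application \<open>v a\<close> is the weight that a set of size \<open>a\<close> contributes through its extension by
  the removed point, and \<open>c a + v a\<close> its weight after the removal. Members in conflict have sizes
  adding up to \<open>s\<close>, so the sizes \<open>a\<close> and \<open>s - a\<close> can be treated together, independently of all others;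
  the induction takes off one such pair of classes at a time.
\<close>

lemma select_subfamily:
  fixes c v :: "nat \<Rightarrow> nat"
  assumes "finite P" and l: "t \<le> l" "l \<ge> 1"
    and "\<And>A. A \<in> P \<Longrightarrow> A \<subseteq> {1..l}"
    and "\<And>A B. A \<in> P \<Longrightarrow> B \<in> P \<Longrightarrow>
        t \<le> card (A \<inter> B) \<or> (A \<union> B = {1..l} \<and> card A + card B = s)"
    and weak: "\<And>a b. t \<le> a \<Longrightarrow> t \<le> b \<Longrightarrow> a + b = s \<Longrightarrow> v a * v b \<le> c a * c b"
    and strict: "\<And>a b. st \<Longrightarrow> t \<le> a \<Longrightarrow> t \<le> b \<Longrightarrow> a + b = s \<Longrightarrow> v a * v b > 0
        \<Longrightarrow> v a * v b < c a * c b"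
    and pos: "\<And>a. st \<Longrightarrow> t \<le> a \<Longrightarrow> c a + v a > 0 \<Longrightarrow> c a > 0"
    and mid: "\<And>a. t \<le> a \<Longrightarrow> a + a = s \<Longrightarrow> l * v a \<le> (l - a) * (c a + v a)"
    and mid_strict: "\<And>a. st \<Longrightarrow> t \<le> a \<Longrightarrow> a + a = s \<Longrightarrow> c a + v a > 0
        \<Longrightarrow> l * v a < (l - a) * (c a + v a)"
  shows "\<exists>C\<subseteq>P. t_inter t C \<and> (\<Sum>A\<in>P. v (card A)) \<le> (\<Sum>A\<in>C. c (card A) + v (card A)) \<and>
    (st \<and> (\<exists>A\<in>P. c (card A) + v (card A) > 0) \<longrightarrow>
      (\<Sum>A\<in>P. v (card A)) < (\<Sum>A\<in>C. c (card A) + v (card A)))"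
  using assms(1,4,5)
proof (induction "card P" arbitrary: P rule: less_induct)
  case less
  note fin = less.prems(1) and sub = less.prems(2) and conf = less.prems(3)
  have ge: "t \<le> card A" if "A \<in> P" for A using conf[OF that that] l by auto
  show ?case
  proof (cases "P = {}")
    case True then show ?thesis by (auto simp: t_inter_def)
  next
    case False
    then obtain A0 where A0: "A0 \<in> P" by auto
    define a where "a = card A0"
    define Pa where "Pa = {B \<in> P. card B = a}"
    define Pb where "Pb = {B \<in> P. card B + a = s}"
    define R where "R = P - (Pa \<union> Pb)"
    have ta: "t \<le> a" using ge A0 a_def by simp
    have "R \<subset> P" using A0 by (auto simp: R_def Pa_def a_def)
    then have "card R < card P" using fin by (rule psubset_card_mono[rotated])
    moreover have "finite R" using fin by (auto simp: R_def)
    ultimately obtain C where C: "C \<subseteq> R" "t_inter t C"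
      "(\<Sum>A\<in>R. v (card A)) \<le> (\<Sum>A\<in>C. c (card A) + v (card A))"
      "st \<and> (\<exists>A\<in>R. c (card A) + v (card A) > 0) \<longrightarrow>
        (\<Sum>A\<in>R. v (card A)) < (\<Sum>A\<in>C. c (card A) + v (card A))"
      using less.hyps[of R] sub conf unfolding R_def by (metis (no_types, lifting) DiffD1)
    \<comment> \<open>The choice among the sizes \<open>a\<close> and \<open>s - a\<close>; conflicts with \<open>R\<close> are impossible.\<close>
    have "\<exists>D\<subseteq>Pa \<union> Pb. t_inter t D \<and>
      (\<Sum>A\<in>Pa\<union>Pb. v (card A)) \<le> (\<Sum>A\<in>D. c (card A) + v (card A)) \<and>
      (st \<and> (\<exists>A\<in>Pa\<union>Pb. c (card A) + v (card A) > 0) \<longrightarrow>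
        (\<Sum>A\<in>Pa\<union>Pb. v (card A)) < (\<Sum>A\<in>D. c (card A) + v (card A)))"
    proof (cases "a + a = s")
      case True
      then have Pb: "Pb = Pa" by (auto simp: Pa_def Pb_def)
      obtain y where y: "y \<in> {1..l}" "card Pa * (l - a) \<le> l * card {A \<in> Pa. y \<notin> A}"
      proof -
        have "\<exists>y\<in>{1..l}. card Pa * (l - a) \<le> l * card {A \<in> Pa. y \<notin> A}"
          using fin sub l by (intro missed_element) (auto simp: Pa_def)
        then show ?thesis using that by blast
      qed
      \<comment> \<open>Two sets that both miss \<open>y\<close> do not cover \<open>{1..l}\<close>, so they are not in conflict.\<close>
      define D where "D = {A \<in> Pa. y \<notin> A}"
      have D: "t_inter t D" using conf y(1) unfolding t_inter_def D_def Pa_def by blast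
      have sums: "(\<Sum>A\<in>Pa. v (card A)) = card Pa * v a"
        "(\<Sum>A\<in>D. c (card A) + v (card A)) = card D * (c a + v a)"
        by (auto simp: Pa_def D_def)
      have le: "card Pa * ((l - a) * (c a + v a)) \<le> l * (card D * (c a + v a))"
        using mult_le_mono1[OF y(2), of "c a + v a"] by (simp add: D_def mult.assoc)
      have "card Pa * (l * v a) \<le> card Pa * ((l - a) * (c a + v a))"
        using mid[OF ta True] by simp
      also note le
      finally have "l * (card Pa * v a) \<le> l * (card D * (c a + v a))" by (simp add: mult.left_commute)
      then have 1: "card Pa * v a \<le> card D * (c a + v a)" using l by simp
      have 2: "card Pa * v a < card D * (c a + v a)" if st "c a + v a > 0"
      proof -
        have "card Pa > 0" using A0 fin by (auto simp: card_gt_0_iff Pa_def a_def)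
        then have "card Pa * (l * v a) < card Pa * ((l - a) * (c a + v a))"
          using mid_strict[OF that(1) ta True that(2)] by simp
        also note le
        finally have "l * (card Pa * v a) < l * (card D * (c a + v a))"
          by (simp only: mult.left_commute)
        then show ?thesis by simp
      qed
      have "\<exists>A\<in>Pa. c (card A) + v (card A) > 0 \<Longrightarrow> c a + v a > 0" by (auto simp: Pa_def)
      moreover have "D \<subseteq> Pa" by (auto simp: D_def)
      ultimately show ?thesis using D 1 2 unfolding Pb Un_absorb
        by (intro exI[of _ D]) (simp add: sums)
    next
      case False
      define b where "b = s - a"
      have cb: "card B = b" if "B \<in> Pb" for B using that by (auto simp: Pb_def b_def)
      have finab: "finite Pa" "finite Pb" using fin by (auto simp: Pa_def Pb_def)
      have disj: "Pa \<inter> Pb = {}" using False by (auto simp: Pa_def Pb_def)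
      have tb: "t \<le> b" "a + b = s" if "card Pb > 0"
      proof -
        have "Pb \<noteq> {}" using \<open>card Pb > 0\<close> by (metis card.empty less_irrefl)
        then obtain B where "B \<in> Pb" by blast
        then have "B \<in> P" "card B + a = s" unfolding Pb_def by auto
        then show "t \<le> b" "a + b = s" using ge[of B] unfolding b_def by auto
      qed
      have inta: "t_inter t Pa" unfolding t_inter_def
      proof (intro ballI)
        fix A B assume AB: "A \<in> Pa" "B \<in> Pa"
        then have "A \<in> P" "B \<in> P" "card A + card B \<noteq> s" using False by (auto simp: Pa_def)
        then show "t \<le> card (A \<inter> B)" using conf[of A B] by simp
      qed
      have intb: "t_inter t Pb"
        unfolding t_inter_def
      proof (intro ballI)
        fix A B assume AB: "A \<in> Pb" "B \<in> Pb"
        then have "A \<in> P" "B \<in> P" "card A + card B \<noteq> s" using False by (auto simp: Pb_def)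
        then show "t \<le> card (A \<inter> B)" using conf[of A B] by simp
      qed
      have sums: "(\<Sum>A\<in>Pa\<union>Pb. v (card A)) = card Pa * v a + card Pb * v b"
        "(\<Sum>A\<in>Pa. c (card A) + v (card A)) = card Pa * (c a + v a)"
        "(\<Sum>A\<in>Pb. c (card A) + v (card A)) = card Pb * (c b + v b)"
        using finab disj cb by (auto simp: sum.union_disjoint Pa_def)
      have ex: "\<exists>A\<in>Pa\<union>Pb. c (card A) + v (card A) > 0
          \<Longrightarrow> card Pa * (c a + v a) > 0 \<or> card Pb * (c b + v b) > 0"
        using finab cb by (fastforce simp: card_gt_0_iff Pa_def)
      let ?pos = "card Pa * (c a + v a) > 0 \<or> card Pb * (c b + v b) > 0"
      define gain where "gain D \<longleftrightarrow> card Pa * v a + card Pb * v b \<le> D \<and>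
          (st \<and> ?pos \<longrightarrow> card Pa * v a + card Pb * v b < D)" for D
      have "gain (card Pa * (c a + v a)) \<or> gain (card Pb * (c b + v b))"
        unfolding gain_def
      proof (rule better_class)
        show "v a * v b \<le> c a * c b" if "card Pb > 0"
          using weak[OF ta tb[OF that]] .
        show "v a * v b < c a * c b" if "card Pb > 0" st "v a * v b > 0"
          using strict[OF that(2) ta tb[OF that(1)] that(3)] .
        show "c a > 0" if st "c a + v a > 0" using pos[OF that(1) ta that(2)] .
        show "c b > 0" if "card Pb > 0" st "c b + v b > 0"
          using pos[OF that(2) tb(1)[OF that(1)] that(3)] .
      qed
      then show ?thesis
      proof
        assume "gain (card Pa * (c a + v a))"
        then have "(\<Sum>A\<in>Pa\<union>Pb. v (card A)) \<le> (\<Sum>A\<in>Pa. c (card A) + v (card A))"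
          "st \<and> ?pos \<longrightarrow> (\<Sum>A\<in>Pa\<union>Pb. v (card A)) < (\<Sum>A\<in>Pa. c (card A) + v (card A))"
          unfolding gain_def sums by simp_all
        with ex inta show ?thesis by (intro exI[of _ Pa] conjI impI) (simp_all only: Un_upper1 Un_upper2)
      next
        assume "gain (card Pb * (c b + v b))"
        then have "(\<Sum>A\<in>Pa\<union>Pb. v (card A)) \<le> (\<Sum>A\<in>Pb. c (card A) + v (card A))"
          "st \<and> ?pos \<longrightarrow> (\<Sum>A\<in>Pa\<union>Pb. v (card A)) < (\<Sum>A\<in>Pb. c (card A) + v (card A))"
          unfolding gain_def sums by simp_all
        with ex intb show ?thesis by (intro exI[of _ Pb] conjI impI) (simp_all only: Un_upper1 Un_upper2)
      qed
    qed
    then obtain D where D: "D \<subseteq> Pa \<union> Pb" "t_inter t D"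
      "(\<Sum>A\<in>Pa\<union>Pb. v (card A)) \<le> (\<Sum>A\<in>D. c (card A) + v (card A))"
      "st \<and> (\<exists>A\<in>Pa\<union>Pb. c (card A) + v (card A) > 0) \<longrightarrow>
        (\<Sum>A\<in>Pa\<union>Pb. v (card A)) < (\<Sum>A\<in>D. c (card A) + v (card A))" by auto
    have cross: "t \<le> card (A \<inter> B)" if "A \<in> C" "B \<in> D" for A B
    proof -
      have "A \<in> R" "B \<in> Pa \<union> Pb" using that C(1) D(1) by blast+
      then have A: "A \<in> P" "card A \<noteq> a" "card A + a \<noteq> s"
        and B: "B \<in> P" "card B = a \<or> card B + a = s"
        by (auto simp: R_def Pa_def Pb_def)
      then have "card A + card B \<noteq> s" by linarith
      with A B show ?thesis using conf[of A B] by simp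
    qed
    have int: "t_inter t (C \<union> D)"
      unfolding t_inter_def
    proof (intro ballI)
      fix A B assume "A \<in> C \<union> D" "B \<in> C \<union> D"
      then show "t \<le> card (A \<inter> B)"
        using t_interD[OF C(2)] t_interD[OF D(2)] cross[of A B] cross[of B A]
        by (auto simp: Int_commute)
    qed
    have P: "P = R \<union> (Pa \<union> Pb)" "R \<inter> (Pa \<union> Pb) = {}" by (auto simp: R_def Pa_def Pb_def)
    have CD: "C \<union> D \<subseteq> P" "C \<inter> D = {}" using C(1) D(1) P by auto
    have f: "finite R" "finite (Pa \<union> Pb)" "finite C" "finite D"
      using fin P CD by (metis finite_Un finite_subset)+
    have sP: "(\<Sum>A\<in>P. v (card A)) = (\<Sum>A\<in>R. v (card A)) + (\<Sum>A\<in>Pa\<union>Pb. v (card A))"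
      using f P by (metis sum.union_disjoint)
    have sC: "(\<Sum>A\<in>C\<union>D. c (card A) + v (card A)) =
      (\<Sum>A\<in>C. c (card A) + v (card A)) + (\<Sum>A\<in>D. c (card A) + v (card A))"
      using f CD by (intro sum.union_disjoint) auto
    have ex: "(\<exists>A\<in>P. c (card A) + v (card A) > 0) \<longleftrightarrow>
      (\<exists>A\<in>R. c (card A) + v (card A) > 0) \<or> (\<exists>A\<in>Pa \<union> Pb. c (card A) + v (card A) > 0)"
      using P(1) by blast
    show ?thesis
    proof (intro exI[of _ "C \<union> D"] conjI impI)
      show "C \<union> D \<subseteq> P" "t_inter t (C \<union> D)" by fact+
      show "(\<Sum>A\<in>P. v (card A)) \<le> (\<Sum>A\<in>C \<union> D. c (card A) + v (card A))"
        unfolding sP sC using C(3) D(3) by (rule add_mono)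
      assume "st \<and> (\<exists>A\<in>P. c (card A) + v (card A) > 0)"
      then show "(\<Sum>A\<in>P. v (card A)) < (\<Sum>A\<in>C \<union> D. c (card A) + v (card A))"
        unfolding sP sC ex using C(3,4) D(3,4) by linarith
    qed
  qed
qed

section \<open>Weights of the layers\<close>

text \<open>
  The number of ways to complete a set of size \<open>a\<close> to one of size \<open>r\<close> by means of \<open>M\<close> further points.
  The case distinction matters, since \<open>r - a\<close> would be truncated to \<open>0\<close> for \<open>a > r\<close>.
\<close>

definition layer_weight :: "nat \<Rightarrow> nat \<Rightarrow> nat \<Rightarrow> nat" where
  "layer_weight M r a = (if a \<le> r then M choose (r - a) else 0)"

lemma layer_weight_Suc:
  "layer_weight (Suc m) r a = layer_weight m r a + layer_weight m r (Suc a)"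
proof (cases "a < r")
  case True
  then have "r - a = Suc (r - Suc a)" by simp
  then show ?thesis using True by (simp add: layer_weight_def)
qed (auto simp: layer_weight_def)

text \<open>
  The hypothesis of \<open>better_class\<close> on the weights. For \<open>x = r - a - 1\<close> and \<open>y = r - b - 1\<close>, the ratio
  of the right to the left side is \<open>(m - x) (m - y) / ((x + 1) (y + 1))\<close>, which is at least \<open>1\<close> when
  \<open>x + y + 1 \<le> m\<close>. If \<open>a\<close> or \<open>b\<close> is at least \<open>r\<close>, the left side vanishes.
\<close>

lemma layer_weight_pair:
  assumes "2 * r \<le> m + 1 + a + b \<or> r \<le> a \<or> r \<le> b"
  shows "layer_weight m r (Suc a) * layer_weight m r (Suc b) \<le> layer_weight m r a * layer_weight m r b"
    and "2 * r < m + 1 + a + b \<or> r \<le> a \<or> r \<le> b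
      \<Longrightarrow> layer_weight m r (Suc a) * layer_weight m r (Suc b) > 0
      \<Longrightarrow> layer_weight m r (Suc a) * layer_weight m r (Suc b) < layer_weight m r a * layer_weight m r b"
proof -
  have "layer_weight m r (Suc a) * layer_weight m r (Suc b) \<le> layer_weight m r a * layer_weight m r b \<and>
    (2 * r < m + 1 + a + b \<or> r \<le> a \<or> r \<le> b
      \<longrightarrow> layer_weight m r (Suc a) * layer_weight m r (Suc b) > 0
      \<longrightarrow> layer_weight m r (Suc a) * layer_weight m r (Suc b) < layer_weight m r a * layer_weight m r b)"
  proof (cases "a < r \<and> b < r")
    case True
    define x y where "x = r - Suc a" and "y = r - Suc b"
    have xy: "r - a = Suc x" "r - b = Suc y" "x + y + 1 \<le> m"
      using True assms by (auto simp: x_def y_def)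
    have absorb: "Suc k * (m choose Suc k) = (m - k) * (m choose k)" for k
      by (simp only: binomial_absorption binomial_absorb_comp)
    let ?L = "(m choose x) * (m choose y)" and ?R = "(m choose Suc x) * (m choose Suc y)"
    have eq: "(Suc x * Suc y) * ?R = ((m - x) * (m - y)) * ?L"
      using absorb[of x] absorb[of y] by (metis (no_types, lifting) mult.assoc mult.left_commute)
    have le: "Suc y * Suc x \<le> (m - x) * (m - y)" using xy by (intro mult_le_mono) auto
    have "(Suc x * Suc y) * ?L \<le> (Suc x * Suc y) * ?R"
      unfolding eq using mult_le_mono1[OF le, of ?L] by (simp only: mult.commute)
    then have 1: "?L \<le> ?R" by (metis mult_le_cancel1 nat_0_less_mult_iff zero_less_Suc)
    have 2: "?L < ?R" if "2 * r < m + 1 + a + b" "?L > 0"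
    proof -
      have "Suc y < m - x" "Suc x < m - y" using that True by (auto simp: x_def y_def)
      then have "Suc y * Suc x < (m - x) * (m - y)" by (intro mult_strict_mono') auto
      then have "(Suc x * Suc y) * ?L < (Suc x * Suc y) * ?R"
        unfolding eq using that(2) by (metis mult.commute mult_less_cancel2)
      then show ?thesis by (metis mult_less_cancel1)
    qed
    show ?thesis using 1 2 True xy by (auto simp: layer_weight_def x_def y_def)
  qed (auto simp: layer_weight_def)
  then show "layer_weight m r (Suc a) * layer_weight m r (Suc b) \<le> layer_weight m r a * layer_weight m r b"
    and "2 * r < m + 1 + a + b \<or> r \<le> a \<or> r \<le> b
      \<Longrightarrow> layer_weight m r (Suc a) * layer_weight m r (Suc b) > 0
      \<Longrightarrow> layer_weight m r (Suc a) * layer_weight m r (Suc b) < layer_weight m r a * layer_weight m r b"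
    by blast+
qed

text \<open>
  The two sides differ by exactly \<open>e (t - 1) (e + f + 2)\<close>. For \<open>e = 0\<close> this is zero, so the slack \<open>g\<close>
  in \<open>n = t (r - t) + 2 + g\<close> is the only source of strictness there; this is where the threshold for
  \<open>n\<close> comes from.
\<close>

lemma middle_inequality:
  fixes t e f m g :: nat
  assumes "1 \<le> t" and m: "Suc m + e = t * (e + 1 + f) + 1 + g + f"
  shows "(t + 2 * e + 1) * (1 + f) + (e + 1) * g \<le> (e + 1) * Suc m"
proof -
  have M: "int (Suc m) = int t * (int e + 1 + int f) + 1 + int g + int f - int e"
    using arg_cong[OF m, of int] by (simp add: algebra_simps)
  have "int ((e + 1) * Suc m) - int ((t + 2 * e + 1) * (1 + f) + (e + 1) * g)
      = (int e + 1) * int (Suc m) - ((int t + 2 * int e + 1) * (1 + int f) + (int e + 1) * int g)"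
    by (simp only: of_nat_mult of_nat_add of_nat_1 of_nat_numeral)
  also have "\<dots> = int e * (int t - 1) * (int e + int f + 2)"
    unfolding M by (simp add: algebra_simps)
  also have "\<dots> \<ge> 0" using assms(1) by (intro mult_nonneg_nonneg) auto
  finally show ?thesis by linarith
qed

text \<open>
  At least a fraction \<open>(l - a) / l\<close> of the members of size \<open>a = s - a\<close> can be kept (\<open>missed_element\<close>), so
  the weight of each has to grow by the factor \<open>l / (l - a)\<close> in order to make up for the others. After
  absorbing the binomial coefficients this is \<open>middle_inequality\<close>.
\<close>

lemma layer_weight_middle:
  assumes t: "1 \<le> t" "t \<le> a" and l: "a + a + 1 = l + t" "l < n"
    and n: "r = t \<or> t * (r - t) + 2 \<le> n"
  shows "l * layer_weight (n + r - 2 - l) r (Suc a) \<le> (l - a) * layer_weight (Suc (n + r - 2 - l)) r a"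
    and "r = t \<or> t * (r - t) + 2 < n \<Longrightarrow> layer_weight (Suc (n + r - 2 - l)) r a > 0 \<Longrightarrow>
      l * layer_weight (n + r - 2 - l) r (Suc a) < (l - a) * layer_weight (Suc (n + r - 2 - l)) r a"
proof -
  define m where "m = n + r - 2 - l"
  have "l * layer_weight m r (Suc a) \<le> (l - a) * layer_weight (Suc m) r a \<and>
    (r = t \<or> t * (r - t) + 2 < n \<longrightarrow> layer_weight (Suc m) r a > 0 \<longrightarrow>
      l * layer_weight m r (Suc a) < (l - a) * layer_weight (Suc m) r a)"
  proof (cases "a < r")
    case True
    \<comment> \<open>\<open>e\<close> and \<open>f\<close> are the distances of \<open>a\<close> to the ends of \<open>t \<le> a \<le> r - 1\<close>, and \<open>g\<close> is the slack in the bound on \<open>n\<close>.\<close>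
    define e f g where "e = a - t" and "f = r - Suc a" and "g = n - (t * (r - t) + 2)"
    have par: "a = t + e" "l = t + 2 * e + 1" "r = t + e + 1 + f" "r - t = e + 1 + f"
      using True t l by (auto simp: e_def f_def)
    have ng: "n = t * (e + 1 + f) + 2 + g" using n par(3,4) by (auto simp: g_def)
    have "Suc m + e = t * (e + 1 + f) + 1 + g + f"
      using l(2) par(2,3) ng unfolding m_def by linarith
    from middle_inequality[OF t(1) this]
    have ineq: "l * Suc f + (l - a) * g \<le> (l - a) * Suc m" using par by simp
    have ab: "Suc f * (Suc m choose Suc f) = Suc m * (m choose f)" by (rule Suc_times_binomial_eq[symmetric, simplified mult.commute])
    have w: "layer_weight m r (Suc a) = m choose f" "layer_weight (Suc m) r a = Suc m choose Suc f"
      using True by (auto simp: layer_weight_def f_def Suc_diff_Suc)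
    have eq: "Suc f * ((l - a) * (Suc m choose Suc f)) = ((l - a) * Suc m) * (m choose f)"
      using ab by (metis (no_types, lifting) mult.assoc mult.left_commute)
    have "(l * Suc f) * (m choose f) \<le> ((l - a) * Suc m) * (m choose f)"
      using ineq by (intro mult_le_mono1) linarith
    then have "Suc f * (l * (m choose f)) \<le> Suc f * ((l - a) * (Suc m choose Suc f))"
      unfolding eq by (simp only: mult.commute mult.left_commute)
    then have 1: "l * (m choose f) \<le> (l - a) * (Suc m choose Suc f)" by (metis Suc_mult_le_cancel1)
    have 2: "l * (m choose f) < (l - a) * (Suc m choose Suc f)"
      if "t * (r - t) + 2 < n" "Suc m choose Suc f > 0"
    proof -
      have "(l - a) * g > 0" using that par by (simp add: g_def)
      then have "l * Suc f < (l - a) * Suc m" using ineq by linarith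
      moreover have "m choose f > 0" using that(2)
        by (simp add: zero_less_binomial_iff del: binomial_Suc_Suc)
      ultimately have "Suc f * (l * (m choose f)) < Suc f * ((l - a) * (Suc m choose Suc f))"
        unfolding eq by (metis mult.assoc mult.commute mult_less_cancel2)
      then show ?thesis by (metis Suc_mult_less_cancel1)
    qed
    have "r \<noteq> t" using par by simp
    then show ?thesis using 1 2 by (simp add: w)
  next
    case False
    have "l - a > 0" using t l by simp
    then show ?thesis using False by (auto simp: layer_weight_def)
  qed
  then show "l * layer_weight (n + r - 2 - l) r (Suc a) \<le> (l - a) * layer_weight (Suc (n + r - 2 - l)) r a"
    and "r = t \<or> t * (r - t) + 2 < n \<Longrightarrow> layer_weight (Suc (n + r - 2 - l)) r a > 0 \<Longrightarrow>
      l * layer_weight (n + r - 2 - l) r (Suc a) < (l - a) * layer_weight (Suc (n + r - 2 - l)) r a"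
    unfolding m_def by blast+
qed

section \<open>Removing the last point\<close>

definition family_weight :: "nat \<Rightarrow> nat \<Rightarrow> nat set set \<Rightarrow> nat" where
  "family_weight M r F = (\<Sum>A\<in>F. layer_weight M r (card A))"

text \<open>
  The family \<open>G\<close> consists of the members that avoid \<open>Suc l\<close> and of a selection from the sets \<open>A\<close> that
  belong to the family only together with \<open>Suc l\<close>. If the bound on \<open>n\<close> is strict, equality forces all
  such sets to have weight zero, so that the members avoiding \<open>Suc l\<close> carry the whole weight by
  themselves. These are closed under supersets, which \<open>G\<close> need not be, and hence suitable for a
  further step.
\<close>

lemma eliminate_last:
  assumes t: "1 \<le> t" "t \<le> r" "t \<le> l" and l: "l < n"
    and n: "r = t \<or> t * (r - t) + 2 \<le> n"
    and F: "F \<subseteq> Pow {1..Suc l}" "t_inter t F" "up_closed {1..Suc l} F"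
    and stable: "\<And>A x. A \<in> F \<Longrightarrow> Suc l \<in> A \<Longrightarrow> x \<in> {1..l} - A \<Longrightarrow> insert x (A - {Suc l}) \<in> F"
  defines "m \<equiv> n + r - 2 - l"
  shows "\<exists>G\<subseteq>Pow {1..l}. t_inter t G \<and> family_weight m r F \<le> family_weight (Suc m) r G \<and>
    ((r = t \<or> t * (r - t) + 2 < n) \<longrightarrow> family_weight m r F = family_weight (Suc m) r G \<longrightarrow>
      family_weight (Suc m) r {A \<in> F. Suc l \<notin> A} = family_weight m r F)"
proof -
  let ?z = "Suc l"
  define st where "st \<longleftrightarrow> r = t \<or> t * (r - t) + 2 < n"
  define F0 where "F0 = {A \<in> F. ?z \<notin> A}"
  define P where "P = {A. ?z \<notin> A \<and> insert ?z A \<in> F \<and> A \<notin> F}"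
  define c where "c = (\<lambda>a. layer_weight m r a)"
  define v where "v = (\<lambda>a. layer_weight m r (Suc a))"
  have cv: "c a + v a = layer_weight (Suc m) r a" for a
    by (simp add: c_def v_def layer_weight_Suc)
  have sub: "A \<subseteq> {1..l}" if "?z \<notin> A" "A \<subseteq> {1..?z}" for A
    using that by (force simp: le_Suc_eq)
  have F0: "F0 \<subseteq> Pow {1..l}" using F(1) sub unfolding F0_def by blast
  have P: "P \<subseteq> Pow {1..l}" using F(1) sub unfolding P_def by blast
  have fin: "finite F" "finite F0" "finite P"
    using F(1) F0 P by (auto intro: finite_subset[OF _ finite_Pow_iff[THEN iffD2]])
  have finA: "finite A" if "A \<in> F0 \<union> P" for A using that F0 P by (auto intro: finite_subset[OF _ finite_atLeastAtMost])
  have ins: "insert ?z A \<in> F" if "A \<in> F0" for A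
    using F that unfolding F0_def by (auto elim!: up_closedD)
  \<comment> \<open>The members through \<open>Suc l\<close> are the extensions of \<open>F0\<close> and of \<open>P\<close>.\<close>
  have split: "F = F0 \<union> insert ?z ` (F0 \<union> P)"
  proof
    show "F0 \<union> insert ?z ` (F0 \<union> P) \<subseteq> F" using ins by (auto simp: F0_def P_def)
    show "F \<subseteq> F0 \<union> insert ?z ` (F0 \<union> P)"
    proof
      fix A assume A: "A \<in> F"
      show "A \<in> F0 \<union> insert ?z ` (F0 \<union> P)"
      proof (cases "?z \<in> A")
        case True
        then have "A = insert ?z (A - {?z})" by auto
        moreover have "A - {?z} \<in> F0 \<union> P" using A calculation by (auto simp: F0_def P_def)
        ultimately show ?thesis by blast
      qed (use A in \<open>auto simp: F0_def\<close>)
    qed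
  qed
  have inj: "inj_on (insert ?z) (F0 \<union> P)"
    by (rule inj_onI) (metis (no_types, lifting) F0_def P_def UnE insert_ident mem_Collect_eq)
  have "family_weight m r F = family_weight m r F0 + family_weight m r (insert ?z ` (F0 \<union> P))"
    unfolding family_weight_def using fin
    by (subst split, subst sum.union_disjoint) (auto simp: F0_def)
  also have "family_weight m r (insert ?z ` (F0 \<union> P)) = (\<Sum>A\<in>F0 \<union> P. v (card A))"
    unfolding family_weight_def
  proof (subst sum.reindex[OF inj], rule sum.cong[OF refl])
    fix A assume A: "A \<in> F0 \<union> P"
    then have "?z \<notin> A" by (auto simp: F0_def P_def)
    then show "((\<lambda>A. layer_weight m r (card A)) \<circ> insert ?z) A = v (card A)"
      using finA[OF A] by (simp add: v_def)
  qed
  also have "\<dots> = (\<Sum>A\<in>F0. v (card A)) + (\<Sum>A\<in>P. v (card A))"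
    using fin by (intro sum.union_disjoint) (auto simp: F0_def P_def)
  finally have wF: "family_weight m r F = family_weight (Suc m) r F0 + (\<Sum>A\<in>P. v (card A))"
    by (simp add: family_weight_def layer_weight_Suc v_def sum.distrib)
  \<comment> \<open>If some \<open>x \<le> l\<close> lies in neither set, stability lets \<open>A\<close> trade \<open>Suc l\<close> for \<open>x\<close>, which costs a common point.\<close>
  have conf: "t \<le> card (A \<inter> B) \<or> (A \<union> B = {1..l} \<and> card A + card B = l + t - 1)"
    if AB: "A \<in> P" "B \<in> P" for A B
  proof (cases "t \<le> card (A \<inter> B)")
    case False
    have AB': "insert ?z A \<in> F" "insert ?z B \<in> F" "?z \<notin> A" "?z \<notin> B" using AB by (auto simp: P_def)
    have f: "finite A" "finite B" using AB finA by auto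
    have "t \<le> card (insert ?z A \<inter> insert ?z B)" using F(2) AB' by (auto dest: t_interD)
    also have "insert ?z A \<inter> insert ?z B = insert ?z (A \<inter> B)" by auto
    finally have i: "card (A \<inter> B) = t - 1" using AB' f False by simp
    have "A \<union> B = {1..l}"
    proof (rule ccontr)
      assume "A \<union> B \<noteq> {1..l}"
      then obtain x where x: "x \<in> {1..l}" "x \<notin> A" "x \<notin> B" using AB P by blast
      then have "insert x (insert ?z A - {?z}) \<in> F" using AB' by (intro stable) auto
      moreover have "insert ?z A - {?z} = A" using AB' by auto
      ultimately have "insert x A \<in> F" by simp
      then have "t \<le> card (insert x A \<inter> insert ?z B)" using F(2) AB' by (auto dest: t_interD)
      moreover have "insert x A \<inter> insert ?z B = A \<inter> B" using x AB' by auto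
      ultimately show False using False by simp
    qed
    moreover from this have "card A + card B = l + (t - 1)"
      using card_Un_Int[OF f] i by simp
    ultimately show ?thesis using t by auto
  qed simp
  \<comment> \<open>For \<open>r > t\<close>, the pairs of distinct sizes only need \<open>r - t + 2 \<le> n\<close>.\<close>
  have pair: "2 * r \<le> m + 1 + a + b \<or> r \<le> a \<or> r \<le> b" "st \<Longrightarrow> 2 * r < m + 1 + a + b \<or> r \<le> a \<or> r \<le> b"
    if "t \<le> a" "t \<le> b" "a + b = l + t - 1" for a b
  proof -
    have k: "r = t \<or> r - t \<le> t * (r - t)" using t by simp
    show "2 * r \<le> m + 1 + a + b \<or> r \<le> a \<or> r \<le> b" using k n that t l unfolding m_def by linarith
    show "2 * r < m + 1 + a + b \<or> r \<le> a \<or> r \<le> b" if st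
      using k that \<open>t \<le> a\<close> \<open>t \<le> b\<close> \<open>a + b = l + t - 1\<close> t l unfolding m_def st_def by linarith
  qed
  have "\<exists>C\<subseteq>P. t_inter t C \<and> (\<Sum>A\<in>P. v (card A)) \<le> (\<Sum>A\<in>C. c (card A) + v (card A)) \<and>
    (st \<and> (\<exists>A\<in>P. c (card A) + v (card A) > 0) \<longrightarrow>
      (\<Sum>A\<in>P. v (card A)) < (\<Sum>A\<in>C. c (card A) + v (card A)))"
  proof (rule select_subfamily[where s = "l + t - 1" and l = l, OF fin(3) t(3)])
    show "1 \<le> l" using t by simp
    show "A \<subseteq> {1..l}" if "A \<in> P" for A using that P by auto
    show "t \<le> card (A \<inter> B) \<or> (A \<union> B = {1..l} \<and> card A + card B = l + t - 1)"
      if "A \<in> P" "B \<in> P" for A B using conf that .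
    show "v a * v b \<le> c a * c b" if "t \<le> a" "t \<le> b" "a + b = l + t - 1" for a b
      unfolding v_def c_def by (rule layer_weight_pair(1)[OF pair(1)[OF that]])
    show "v a * v b < c a * c b" if "st" "t \<le> a" "t \<le> b" "a + b = l + t - 1" "v a * v b > 0" for a b
      using that(5) unfolding v_def c_def
      by (intro layer_weight_pair(2)[OF pair(1)[OF that(2-4)] pair(2)[OF that(2-4) that(1)]])
    show "c a > 0" if "st" "t \<le> a" "c a + v a > 0" for a
    proof -
      have "a \<le> r" using that(3) by (auto simp: c_def v_def layer_weight_def split: if_splits)
      moreover have "r - a \<le> m" using that(2) t l by (simp add: m_def)
      ultimately show ?thesis by (simp add: c_def layer_weight_def zero_less_binomial_iff)
    qed
    show "l * v a \<le> (l - a) * (c a + v a)" if "t \<le> a" "a + a = l + t - 1" for a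
      unfolding cv unfolding v_def m_def
      using that t l n by (intro layer_weight_middle(1)) auto
    show "l * v a < (l - a) * (c a + v a)" if "st" "t \<le> a" "a + a = l + t - 1" "c a + v a > 0" for a
      using that(4) unfolding cv unfolding v_def m_def
      using that(1-3) t l n unfolding st_def by (intro layer_weight_middle(2)) auto
  qed
  then obtain C where C: "C \<subseteq> P" "t_inter t C"
    "(\<Sum>A\<in>P. v (card A)) \<le> family_weight (Suc m) r C"
    "st \<and> (\<exists>A\<in>P. c (card A) + v (card A) > 0) \<longrightarrow> (\<Sum>A\<in>P. v (card A)) < family_weight (Suc m) r C"
    unfolding family_weight_def cv by blast
  have wG: "family_weight (Suc m) r (F0 \<union> C) = family_weight (Suc m) r F0 + family_weight (Suc m) r C"
    unfolding family_weight_def using C(1) fin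
    by (intro sum.union_disjoint) (auto simp: F0_def P_def intro: finite_subset)
  have cross: "t \<le> card (A \<inter> B)" if "A \<in> F0" "B \<in> C" for A B
  proof -
    have "A \<in> F" "insert ?z B \<in> F" "?z \<notin> A" using that C(1) by (auto simp: F0_def P_def)
    moreover from this have "A \<inter> insert ?z B = A \<inter> B" by auto
    ultimately show ?thesis using F(2) by (metis t_interD)
  qed
  have "t_inter t F0" using F(2) by (auto simp: F0_def t_inter_def)
  then have ti: "t_inter t (F0 \<union> C)"
    unfolding t_inter_def
  proof (intro ballI)
    fix A B assume "A \<in> F0 \<union> C" "B \<in> F0 \<union> C"
    then show "t \<le> card (A \<inter> B)"
      using t_interD[OF \<open>t_inter t F0\<close>] t_interD[OF C(2)] cross[of A B] cross[of B A]
      by (auto simp: Int_commute)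
  qed
  show ?thesis
  proof (intro exI[of _ "F0 \<union> C"] conjI impI)
    show "F0 \<union> C \<subseteq> Pow {1..l}" using F0 P C(1) by auto
    show "t_inter t (F0 \<union> C)" by fact
    show "family_weight m r F \<le> family_weight (Suc m) r (F0 \<union> C)"
      unfolding wF wG using C(3) by simp
    assume "r = t \<or> t * (r - t) + 2 < n"
      and "family_weight m r F = family_weight (Suc m) r (F0 \<union> C)"
    then have "\<forall>A\<in>P. v (card A) = 0" using C(4) unfolding wF wG st_def by auto
    then show "family_weight (Suc m) r {A \<in> F. ?z \<notin> A} = family_weight m r F"
      unfolding wF by (simp add: F0_def)
  qed
qed

definition up_gen :: "nat set \<Rightarrow> nat set set \<Rightarrow> nat set set" where
  "up_gen X F = {B. B \<subseteq> X \<and> (\<exists>A\<in>F. A \<subseteq> B)}"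

lemma up_gen:
  assumes "finite X"
  shows "up_gen X F \<subseteq> Pow X" "up_closed X (up_gen X F)" "F \<subseteq> Pow X \<Longrightarrow> F \<subseteq> up_gen X F"
    and "t_inter t F \<Longrightarrow> t_inter t (up_gen X F)"
proof -
  show "up_gen X F \<subseteq> Pow X" "up_closed X (up_gen X F)" "F \<subseteq> Pow X \<Longrightarrow> F \<subseteq> up_gen X F"
    by (auto simp: up_gen_def up_closed_def)
  assume ti: "t_inter t F"
  have "t \<le> card (A \<inter> B)" if AB: "A \<in> up_gen X F" "B \<in> up_gen X F" for A B
  proof -
    obtain A' B' where "A' \<in> F" "B' \<in> F" and s: "A' \<subseteq> A" "B' \<subseteq> B" using AB by (auto simp: up_gen_def)
    then have "t \<le> card (A' \<inter> B')" using ti by (auto dest: t_interD)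
    also have "A' \<inter> B' \<subseteq> A \<inter> B" using s by auto
    then have "card (A' \<inter> B') \<le> card (A \<inter> B)"
      using AB assms by (intro card_mono) (auto simp: up_gen_def intro: finite_subset)
    finally show ?thesis .
  qed
  then show "t_inter t (up_gen X F)" by (auto simp: t_inter_def)
qed

text \<open>
  By induction on \<open>l\<close>. In the case of equality, the induction hypothesis is applied to the members that
  avoid the last point, and the resulting set of size \<open>t\<close> is carried back through the shifts because
  these preserve the sizes that occur.
\<close>

theorem t_inter_weight_bound:
  assumes t: "1 \<le> t" "t \<le> r" and n: "r = t \<or> t * (r - t) + 2 \<le> n"
    and "t \<le> l" "l \<le> n" "F \<subseteq> Pow {1..l}" "t_inter t F" "up_closed {1..l} F"
  shows "family_weight (n + r - 1 - l) r F \<le> (n + r - 1 - t) choose (r - t) \<and>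
    ((r = t \<or> t * (r - t) + 2 < n) \<longrightarrow>
      family_weight (n + r - 1 - l) r F = (n + r - 1 - t) choose (r - t) \<longrightarrow>
      (\<exists>T\<in>F. card T = t))"
  using assms(4-)
proof (induction l arbitrary: F rule: nat_induct_at_least)
  case base
  have one: "A = {1..t}" if "A \<in> F" for A
  proof -
    have "A \<subseteq> {1..t}" "t \<le> card A" using that base.prems(2) t_interD[OF base.prems(3) that that] by auto
    then show ?thesis using card_seteq[of "{1..t}" A] by auto
  qed
  show ?case
  proof (cases "F = {}")
    case True
    have "(n + r - 1 - t) choose (r - t) > 0" using t base.prems(1) by (simp add: zero_less_binomial_iff)
    then show ?thesis using True by (simp add: family_weight_def)
  next
    case False
    then have "F = {{1..t}}" using one by auto
    then show ?thesis using t by (simp add: family_weight_def layer_weight_def)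
  qed
next
  case (Suc l)
  let ?m = "n + r - 2 - l"
  have M: "n + r - 1 - Suc l = ?m" "n + r - 1 - l = Suc ?m" using Suc.prems(1) t by auto
  let ?B = "(n + r - 1 - t) choose (r - t)"
  obtain E where E: "E \<subseteq> Pow {1..Suc l}" "t_inter t E" "up_closed {1..Suc l} E" "card ` E = card ` F"
    "family_weight ?m r E = family_weight ?m r F"
    "\<forall>A\<in>E. Suc l \<in> A \<longrightarrow> (\<forall>x\<in>{1..Suc l} - A. insert x (A - {Suc l}) \<in> E)"
    using exists_stable[OF _ _ Suc.prems(2-4), of "Suc l"] unfolding family_weight_def by auto
  obtain G where G: "G \<subseteq> Pow {1..l}" "t_inter t G"
    "family_weight ?m r E \<le> family_weight (Suc ?m) r G"
    "(r = t \<or> t * (r - t) + 2 < n) \<longrightarrow> family_weight ?m r E = family_weight (Suc ?m) r G \<longrightarrow>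
      family_weight (Suc ?m) r {A \<in> E. Suc l \<notin> A} = family_weight ?m r E"
    using eliminate_last[OF t Suc.hyps _ n E(1-3)] E(6) Suc.prems(1) by auto
  have ln: "l \<le> n" using Suc.prems(1) by simp
  let ?G = "up_gen {1..l} G"
  have "family_weight (Suc ?m) r G \<le> family_weight (Suc ?m) r ?G"
    unfolding family_weight_def using up_gen(1,3)[of "{1..l}" G] G(1)
    by (intro sum_mono2) (auto intro: finite_subset)
  also have "\<dots> \<le> ?B"
    using Suc.IH[OF ln up_gen(1) up_gen(4)[OF _ G(2)] up_gen(2)] unfolding M by simp
  finally have GB: "family_weight (Suc ?m) r G \<le> ?B" .
  show ?case unfolding M
  proof (intro conjI impI)
    show "family_weight ?m r F \<le> ?B" using G(3) GB E(5) by simp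
    assume st: "r = t \<or> t * (r - t) + 2 < n" and eq: "family_weight ?m r F = ?B"
    let ?F0 = "{A \<in> E. Suc l \<notin> A}"
    have "family_weight ?m r E = family_weight (Suc ?m) r G" using eq E(5) G(3) GB by simp
    then have "family_weight (Suc ?m) r ?F0 = ?B" using G(4) st eq E(5) by metis
    moreover have "?F0 \<subseteq> Pow {1..l}" using E(1) by (force simp: le_Suc_eq)
    moreover have "t_inter t ?F0" using E(2) by (auto simp: t_inter_def)
    moreover have "up_closed {1..l} ?F0"
      unfolding up_closed_def
    proof (intro ballI allI impI)
      fix A B assume "A \<in> ?F0" "A \<subseteq> B" "B \<subseteq> {1..l}"
      moreover from this have "B \<subseteq> {1..Suc l}" "Suc l \<notin> B" by auto
      ultimately show "B \<in> ?F0" using E(3) by (auto dest: up_closedD)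
    qed
    ultimately have "\<exists>T\<in>?F0. card T = t" using Suc.IH[OF ln, of ?F0] st unfolding M by blast
    then have "t \<in> card ` E" by auto
    then show "\<exists>T\<in>F. card T = t" unfolding E(4) by auto
  qed
qed

section \<open>Counting multisets by their support\<close>

text \<open>
  The first entry of a sorted list is the minimum of its support. Removing it leaves either the same
  support or the support without its minimum, which gives Pascal's recurrence.
\<close>

lemma card_multisets_with_support:
  fixes S :: "nat set"
  assumes "finite S" "S \<noteq> {}" "1 \<le> r"
  shows "card {a. length a = r \<and> sorted a \<and> set a = S} = layer_weight (r - 1) r (card S)"
  using assms(3,1,2)
proof (induction r arbitrary: S rule: nat_induct_at_least)
  case base
  show ?case
  proof (cases "card S = 1")
    case True
    then obtain x where S: "S = {x}" by (auto simp: card_1_singleton_iff)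
    have "{a. length a = 1 \<and> sorted a \<and> set a = S} = {[x]}"
    proof (intro equalityI subsetI)
      fix a assume "a \<in> {a. length a = 1 \<and> sorted a \<and> set a = S}"
      then have a: "length a = 1" "set a = S" by auto
      then obtain y where "a = [y]" by (cases a) auto
      then show "a \<in> {[x]}" using a S by simp
    qed (simp add: S)
    then have "card {a. length a = 1 \<and> sorted a \<and> set a = S} = card {[x]}" by (rule arg_cong)
    also have "\<dots> = layer_weight (1 - 1) 1 (card S)" unfolding True by (simp add: layer_weight_def)
    finally show ?thesis .
  next
    case False
    have "card S = 1" if "length a = 1" "set a = S" for a using that by (cases a) auto
    then have empty: "{a. length a = 1 \<and> sorted a \<and> set a = S} = {}" using False by blast
    have "card S \<noteq> 0" using base by auto
    then show ?thesis unfolding empty using False by (simp add: layer_weight_def)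
  qed
next
  case (Suc r)
  let ?L = "\<lambda>r S. {a. length a = r \<and> sorted a \<and> set a = (S :: nat set)}"
  let ?m = "Min S"
  have mS: "?m \<in> S" "\<And>x. x \<in> S \<Longrightarrow> ?m \<le> x" using Suc.prems by auto
  have eq: "?L (Suc r) S = Cons ?m ` (?L r S \<union> ?L r (S - {?m}))"
  proof (intro set_eqI iffI)
    fix a assume a: "a \<in> ?L (Suc r) S"
    then obtain x b where ab: "a = x # b" "length b = r" by (auto simp: length_Suc_conv)
    have S: "insert x (set b) = S" and sorted: "sorted b" "\<And>y. y \<in> set b \<Longrightarrow> x \<le> y"
      using a unfolding ab(1) by simp_all
    have x: "?m = x" using S sorted(2) Suc.prems(1) by (intro Min_eqI) auto
    have "set b = S \<or> set b = S - {?m}" unfolding x using S by blast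
    then have "b \<in> ?L r S \<union> ?L r (S - {?m})" using ab(2) sorted(1) by simp
    then show "a \<in> Cons ?m ` (?L r S \<union> ?L r (S - {?m}))" unfolding ab(1) x[symmetric] by (rule imageI)
  next
    fix a assume "a \<in> Cons ?m ` (?L r S \<union> ?L r (S - {?m}))"
    then obtain b where a: "a = ?m # b" and b: "length b = r" "sorted b"
      and "set b = S \<or> set b = S - {?m}" by blast
    then have "insert ?m (set b) = S" "\<And>y. y \<in> set b \<Longrightarrow> ?m \<le> y" using mS by blast+
    then show "a \<in> ?L (Suc r) S" unfolding a using b by simp
  qed
  have finL: "finite (?L r X)" if "finite X" for X
    using finite_lists_length_eq[OF that, of r] by (rule finite_subset[rotated]) auto
  have "card (?L (Suc r) S) = card (?L r S \<union> ?L r (S - {?m}))"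
    unfolding eq by (rule card_image) simp
  also have "\<dots> = card (?L r S) + card (?L r (S - {?m}))"
  proof (rule card_Un_disjoint)
    show "finite (?L r S)" "finite (?L r (S - {?m}))" using finL Suc.prems(1) by blast+
    have "S \<noteq> S - {?m}" using mS(1) by blast
    then show "?L r S \<inter> ?L r (S - {?m}) = {}" by blast
  qed
  also have "card (?L r S) = layer_weight (r - 1) r (card S)"
    using Suc.IH Suc.prems by simp
  finally have c: "card (?L (Suc r) S) = layer_weight (r - 1) r (card S) + card (?L r (S - {?m}))" .
  obtain q where q: "r = Suc q" using Suc.hyps by (cases r) auto
  obtain p where p: "card S = Suc p" using Suc.prems by (cases "card S") auto
  show ?case
  proof (cases "S - {?m} = {}")
    case True
    have "set b \<noteq> {}" if "length b = r" for b :: "nat list" using that q by auto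
    then have "?L r (S - {?m}) = {}" unfolding True by blast
    then have empty: "card (?L r (S - {?m})) = 0" by (simp only: card.empty)
    have "S = {?m}" using True mS(1) by blast
    then have "card S = 1" by (metis card_1_singleton_iff One_nat_def)
    then show ?thesis unfolding c empty by (simp add: q layer_weight_def)
  next
    case False
    then have "card (?L r (S - {?m})) = layer_weight (r - 1) r (card (S - {?m}))"
      using Suc.IH Suc.prems by simp
    also have "card (S - {?m}) = p" using mS p Suc.prems by simp
    finally have "card (?L (Suc r) S) = layer_weight q r (Suc p) + layer_weight q r p"
      using c by (simp add: p q)
    also have "\<dots> = layer_weight r r p" using layer_weight_Suc[of q r p] by (simp add: q)
    also have "\<dots> = layer_weight r (Suc r) (Suc p)" by (simp add: layer_weight_def)
    finally show ?thesis by (simp add: p)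
  qed
qed

lemma finite_multisets: "finite (multisets n r)"
  using finite_lists_length_eq[of "{1..n}" r] by (rule finite_subset[rotated]) (auto simp: multisets_def)

lemma card_multisets_supports:
  assumes F: "F \<subseteq> Pow {1..n}" "{} \<notin> F" and "1 \<le> r"
  shows "card {a \<in> multisets n r. set a \<in> F} = family_weight (r - 1) r F"
proof -
  let ?L = "\<lambda>S. {a. length a = r \<and> sorted a \<and> set a = (S :: nat set)}"
  have fin: "finite S" if "S \<in> F" for S using that F by (auto intro: finite_subset)
  have "{a \<in> multisets n r. set a \<in> F} = (\<Union>S\<in>F. ?L S)"
    using F by (auto simp: multisets_def)
  moreover have "card (\<Union>S\<in>F. ?L S) = (\<Sum>S\<in>F. card (?L S))"
  proof (rule card_UN_disjoint)
    show "finite F" using F by (auto intro: finite_subset)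
    show "\<forall>S\<in>F. finite (?L S)"
      using fin by (auto intro: finite_subset[OF _ finite_lists_length_eq[of _ r]])
  qed auto
  moreover have "\<dots> = family_weight (r - 1) r F"
    unfolding family_weight_def using fin F(2) assms(3)
    by (intro sum.cong card_multisets_with_support) auto
  ultimately show ?thesis by simp
qed

text \<open>
  A completion by points of \<open>D\<close> and of a disjoint set of \<open>M\<close> points is first chosen inside \<open>D\<close>
  (Vandermonde's identity).
\<close>

lemma sum_layer_weight_Pow:
  assumes "finite D"
  shows "(\<Sum>A\<in>Pow D. layer_weight M r (a + card A)) = layer_weight (M + card D) r a"
  using assms
proof (induction D arbitrary: a)
  case (insert x D)
  have fin: "finite A" if "A \<subseteq> D" for A using that insert.hyps(1) finite_subset by auto
  have inj: "inj_on (insert x) (Pow D)"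
    using insert.hyps(2) by (auto simp: inj_on_def insert_ident subset_iff)
  have "(\<Sum>A\<in>Pow (insert x D). layer_weight M r (a + card A)) =
    (\<Sum>A\<in>Pow D. layer_weight M r (a + card A)) + (\<Sum>A\<in>insert x ` Pow D. layer_weight M r (a + card A))"
    unfolding Pow_insert using insert.hyps by (intro sum.union_disjoint) auto
  also have "(\<Sum>A\<in>insert x ` Pow D. layer_weight M r (a + card A)) =
    (\<Sum>A\<in>Pow D. layer_weight M r (Suc a + card A))"
    using insert.hyps(2) fin by (subst sum.reindex[OF inj]) (auto intro!: sum.cong simp: subset_iff card_insert_if)
  also have "(\<Sum>A\<in>Pow D. layer_weight M r (a + card A)) = layer_weight (M + card D) r a"
    by (rule insert.IH)
  also have "(\<Sum>A\<in>Pow D. layer_weight M r (Suc a + card A)) = layer_weight (M + card D) r (Suc a)"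
    by (rule insert.IH)
  finally show ?case using insert.hyps by (simp add: layer_weight_Suc)
qed simp

lemma card_star:
  assumes T: "T \<subseteq> {1..n}" "card T = t" and t: "1 \<le> t" "t \<le> r"
  shows "card {a \<in> multisets n r. T \<subseteq> set a} = (n + r - t - 1) choose (r - t)"
proof -
  have finT: "finite T" using T finite_subset by auto
  have tn: "t \<le> n" using T card_mono[of "{1..n}" T] by simp
  let ?D = "{1..n} - T"
  let ?F = "(\<union>) T ` Pow ?D"
  have F: "?F = {S. S \<subseteq> {1..n} \<and> T \<subseteq> S}"
  proof (intro equalityI subsetI)
    fix S assume "S \<in> {S. S \<subseteq> {1..n} \<and> T \<subseteq> S}"
    then have "S = T \<union> (S - T)" "S - T \<subseteq> ?D" by auto
    then show "S \<in> ?F" by blast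
  qed (use T in auto)
  have "{a \<in> multisets n r. T \<subseteq> set a} = {a \<in> multisets n r. set a \<in> ?F}"
    unfolding F by (auto simp: multisets_def)
  also have "card \<dots> = family_weight (r - 1) r ?F"
    using T t by (intro card_multisets_supports) auto
  also have "\<dots> = (\<Sum>A\<in>Pow ?D. layer_weight (r - 1) r (t + card A))"
    unfolding family_weight_def
  proof (subst sum.reindex)
    show "inj_on ((\<union>) T) (Pow ?D)" by (auto simp: inj_on_def)
    show "(\<Sum>A\<in>Pow ?D. ((\<lambda>A. layer_weight (r - 1) r (card A)) \<circ> (\<union>) T) A) =
      (\<Sum>A\<in>Pow ?D. layer_weight (r - 1) r (t + card A))"
    proof (rule sum.cong[OF refl])
      fix A assume A: "A \<in> Pow ?D"
      then have "finite A" by (auto intro: finite_subset)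
      then have "card (T \<union> A) = t + card A" using A finT T(2) by (subst card_Un_disjoint) auto
      then show "((\<lambda>A. layer_weight (r - 1) r (card A)) \<circ> (\<union>) T) A = layer_weight (r - 1) r (t + card A)"
        by simp
    qed
  qed
  also have "\<dots> = layer_weight (r - 1 + card ?D) r t" by (rule sum_layer_weight_Pow) simp
  also have "card ?D = n - t" using T finT by (simp add: card_Diff_subset)
  also have "r - 1 + (n - t) = n + r - t - 1" using t tn by simp
  finally show ?thesis using t by (simp add: layer_weight_def)
qed

section \<open>Families of multisets\<close>

text \<open>
  The upward closure \<open>F\<close> of the supports weighs at least the number of multisets in the family. In the
  case of equality it has a member \<open>T\<close> of size \<open>t\<close>, all supports contain \<open>T\<close>, and the family is a
  subset of the star of \<open>T\<close> with the same finite cardinality.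
\<close>

theorem t_intersecting_multisets:
  assumes t: "1 \<le> t" "t \<le> r" and n: "r = t \<or> t * (r - t) + 2 \<le> n"
    and A: "\<A> \<subseteq> multisets n r" "t_intersecting t \<A>"
  shows "card \<A> \<le> (n + r - t - 1) choose (r - t)"
    and "r = t \<or> t * (r - t) + 2 < n \<Longrightarrow> card \<A> = (n + r - t - 1) choose (r - t) \<Longrightarrow>
      \<exists>T. T \<subseteq> {1..n} \<and> card T = t \<and> \<A> = {a \<in> multisets n r. T \<subseteq> set a}"
proof -
  let ?B = "(n + r - t - 1) choose (r - t)"
  have "card \<A> \<le> ?B \<and> (r = t \<or> t * (r - t) + 2 < n \<longrightarrow> card \<A> = ?B \<longrightarrow>
      (\<exists>T. T \<subseteq> {1..n} \<and> card T = t \<and> \<A> = {a \<in> multisets n r. T \<subseteq> set a}))"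
  proof (cases "\<A> = {}")
    case True
    have "?B > 0" if "r \<noteq> t \<or> 1 \<le> n" using that n t by (auto simp: zero_less_binomial_iff)
    moreover have "?B > 0" if "r = t" using that by simp
    ultimately show ?thesis using True by auto
  next
    case False
    then obtain a where a: "a \<in> \<A>" by auto
    define F where "F = up_gen {1..n} (set ` \<A>)"
    have S: "set ` \<A> \<subseteq> Pow {1..n}" using A(1) by (auto simp: multisets_def)
    have ti: "t_inter t (set ` \<A>)" using A(2) by (auto simp: t_inter_def t_intersecting_def)
    have F: "F \<subseteq> Pow {1..n}" "up_closed {1..n} F" "set ` \<A> \<subseteq> F" "t_inter t F"
      unfolding F_def using up_gen[where X = "{1..n}" and F = "set ` \<A>"] S ti by auto
    have aS: "set a \<subseteq> {1..n}" using a S by auto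
    have "t \<le> card (set a)" using A(2) a by (force simp: t_intersecting_def)
    also have "\<dots> \<le> n" using card_mono[OF _ aS] by simp
    finally have tn: "t \<le> n" .
    have ne: "{} \<notin> F" using t_interD[OF F(4), of "{}" "{}"] t by auto
    have M: "n + r - 1 - n = r - 1" "n + r - 1 - t = n + r - t - 1" by auto
    have sub: "\<A> \<subseteq> {a \<in> multisets n r. set a \<in> F}" using A(1) F(3) by auto
    have "card \<A> \<le> card {a \<in> multisets n r. set a \<in> F}"
      using finite_multisets sub by (intro card_mono) auto
    also have "\<dots> = family_weight (r - 1) r F" using F(1) ne t by (intro card_multisets_supports) auto
    finally have le: "card \<A> \<le> family_weight (r - 1) r F" .
    note main = t_inter_weight_bound[OF t n tn order.refl F(1,4,2), unfolded M]
    have "\<exists>T. T \<subseteq> {1..n} \<and> card T = t \<and> \<A> = {a \<in> multisets n r. T \<subseteq> set a}"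
      if st: "r = t \<or> t * (r - t) + 2 < n" and eq: "card \<A> = ?B"
    proof -
      have "family_weight (r - 1) r F = ?B" using le main eq by simp
      then obtain T where T: "T \<in> F" "card T = t" using main st by blast
      have T1: "T \<subseteq> {1..n}" using T F(1) by auto
      have "T \<subseteq> set b" if "b \<in> \<A>" for b
      proof -
        have "t \<le> card (T \<inter> set b)" using F(3,4) T that by (auto dest: t_interD)
        then have "T \<inter> set b = T" using T(2) T1 by (intro card_seteq) (auto intro: finite_subset)
        then show ?thesis by auto
      qed
      then have "\<A> \<subseteq> {a \<in> multisets n r. T \<subseteq> set a}" using A(1) by auto
      then have "\<A> = {a \<in> multisets n r. T \<subseteq> set a}"
        using finite_multisets card_star[OF T1 T(2) t] eq by (intro card_subset_eq) auto
      then show ?thesis using T1 T(2) by blast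
    qed
    then show ?thesis using le main by auto
  qed
  then show "card \<A> \<le> ?B"
    and "r = t \<or> t * (r - t) + 2 < n \<Longrightarrow> card \<A> = ?B \<Longrightarrow>
      \<exists>T. T \<subseteq> {1..n} \<and> card T = t \<and> \<A> = {a \<in> multisets n r. T \<subseteq> set a}" by blast+
qed

text \<open>
  For \<open>r > t\<close>, the hypothesis gives \<open>n \<ge> (t + u + 2) (r - t) \<ge> t (r - t) + 2\<close>, and the second
  inequality is strict for \<open>u > 0\<close>.
\<close>

theorem theorem2p6:
  fixes n r t :: nat and u :: real and \<A> :: "nat list set"
  assumes "n \<ge> 1" and "1 \<le> t" and "t \<le> r"
    and "u \<ge> 0" and "u > (6 - real t) / 3"
    and "real n \<ge> (real t + u + 2) * (real r - real t)"
    and "\<A> \<subseteq> multisets n r" and "t_intersecting t \<A>"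
  shows "card \<A> \<le> (n + r - t - 1) choose (r - t) \<and>
    (u > 0 \<longrightarrow>
      (card \<A> = (n + r - t - 1) choose (r - t) \<longleftrightarrow>
        (\<exists>T. T \<subseteq> {1..n} \<and> card T = t \<and> \<A> = {a \<in> multisets n r. T \<subseteq> set a})))"
proof -
  have n: "real (t * (r - t) + 2) \<le> real n \<and> (u > 0 \<longrightarrow> real (t * (r - t) + 2) < real n)" if "r \<noteq> t"
  proof -
    have k: "real (r - t) = real r - real t" "real (r - t) \<ge> 1" using that assms(3) by auto
    have "real t * real (r - t) + 2 * real (r - t) + u * real (r - t) \<le> real n"
      using assms(6) unfolding k(1) by (simp add: algebra_simps)
    moreover have "u * real (r - t) \<ge> 0" using assms(4) by simp
    moreover have "u > 0 \<longrightarrow> u * real (r - t) > 0" using k(2) by simp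
    moreover have "real (t * (r - t) + 2) = real t * real (r - t) + 2" by simp
    ultimately show ?thesis using k(2) by linarith
  qed
  have weak: "r = t \<or> t * (r - t) + 2 \<le> n" using n by linarith
  have strict: "r = t \<or> t * (r - t) + 2 < n" if "u > 0" using n that by linarith
  show ?thesis
    using t_intersecting_multisets[OF assms(2,3) weak assms(7,8)] strict card_star[OF _ _ assms(2,3)]
    by blast
qed

end
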